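(* Let $k\ge 0$ be an integer, let $p_1,\dots,p_k$ be distinct primes, and let $\Gamma_k$ be the $k$-dprime divisor function graph of $n=p_1p_2\cdots p_k$. Then the first Zagreb index of $\Gamma_k$ is $$M_1(\Gamma_k)=2(2^k-1)^2+\sum_{j=1}^{k-1}\binom{k}{j}\bigl(2^j+2^{k-j}-2\bigr)^2.$$
   Context: For $n=p_1p_2\cdots p_k$ with $p_1,\dots,p_k$ distinct primes, the $k$-dprime divisor function graph $\Gamma_k=G_{D(n)}$ is the simple graph with vertex set $V(\Gamma_k)=\{u\in\mathbb{Z}_{>0}: u\mid n\}$ and edge set $E(\Gamma_k)=\{uv: u\neq v,\ u\mid v \text{ or } v\mid u\}$. The first Zagreb index is $M_1(\Gamma_k)=\sum_{u\in V(\Gamma_k)}\deg_{\Gamma_k}(u)^2$. *)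

theory Defs
  imports Complex_Main "HOL-Computational_Algebra.Primes"
begin

text \<open>A simple graph is a pair of a vertex set and a set of edges, where an edge is the
  two-element set of its endpoints.\<close>

type_synonym 'a sgraph = "'a set \<times> 'a set set"

definition verts :: "'a sgraph \<Rightarrow> 'a set" where
  "verts G = fst G"

definition edges :: "'a sgraph \<Rightarrow> 'a set set" where
  "edges G = snd G"

definition degree :: "'a sgraph \<Rightarrow> 'a \<Rightarrow> nat" where
  "degree G u = card {e \<in> edges G. u \<in> e}"

definition first_Zagreb_index :: "'a sgraph \<Rightarrow> nat" where
  "first_Zagreb_index G = (\<Sum>u\<in>verts G. (degree G u)\<^sup>2)"

definition positive_divisors :: "nat \<Rightarrow> nat set" where
  "positive_divisors n = {u. 0 < u \<and> u dvd n}"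

definition divisor_function_graph :: "nat \<Rightarrow> nat sgraph" where
  "divisor_function_graph n =
     (positive_divisors n,
      {{u, v} | u v. u \<in> positive_divisors n \<and> v \<in> positive_divisors n \<and>
                     u \<noteq> v \<and> (u dvd v \<or> v dvd u)})"

end

theory Submission
  imports Defs
begin

text \<open>For a finite set \<open>P\<close> of primes, \<open>A \<mapsto> \<Prod>A\<close> is an order isomorphism from the subsets of \<open>P\<close>
  under inclusion to the divisors of \<open>\<Prod>P\<close> under divisibility. Hence the neighbours of \<open>\<Prod>A\<close> are
  the products over the proper subsets of \<open>A\<close> and over the proper supersets of \<open>A\<close> within \<open>P\<close>, so
  the degree depends on the size of \<open>A\<close> only, and it remains to group the subsets by size.\<close>

text \<open>Degrees count edges as two-element sets. The edges at \<open>u\<close> are the sets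
  \<open>{u, v}\<close> with \<open>v\<close> a neighbour, and \<open>{u, v}\<close> determines
  \<open>v\<close>, so counting neighbours suffices.\<close>

lemma degree_divisor_function_graph:
  assumes "u \<in> positive_divisors n"
  shows "degree (divisor_function_graph n) u =
    card {v \<in> positive_divisors n. v \<noteq> u \<and> (u dvd v \<or> v dvd u)}"
    (is "_ = card ?N")
proof -
  have "{e \<in> edges (divisor_function_graph n). u \<in> e} = (\<lambda>v. {u, v}) ` ?N"
    using assms by (auto simp: edges_def divisor_function_graph_def)
  moreover have "inj_on (\<lambda>v. {u, v}) ?N"
    by (auto simp: inj_on_def doubleton_eq_iff)
  ultimately show ?thesis
    by (simp add: degree_def card_image)
qed

text \<open>A prime in \<open>A\<close> divides the product over \<open>B\<close>, hence some member
  of \<open>B\<close>; that member is itself prime, so the two are equal.\<close>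

lemma prod_primes_dvd_iff:
  fixes A B :: "nat set"
  assumes "finite A" "finite B" "\<forall>q\<in>A. prime q" "\<forall>q\<in>B. prime q"
  shows "\<Prod>A dvd \<Prod>B \<longleftrightarrow> A \<subseteq> B"
proof
  assume dvd: "\<Prod>A dvd \<Prod>B"
  show "A \<subseteq> B"
  proof
    fix q assume "q \<in> A"
    with assms have "prime q" "q dvd \<Prod>A" by auto
    with dvd have "q dvd \<Prod>B" by (meson dvd_trans)
    then obtain r where "r \<in> B" "q dvd r"
      using \<open>prime q\<close> assms(2) by (auto simp: prime_dvd_prod_iff)
    with \<open>prime q\<close> assms(4) show "q \<in> B"
      by (metis primes_dvd_imp_eq)
  qed
next
  assume "A \<subseteq> B"
  with assms show "\<Prod>A dvd \<Prod>B" by (intro prod_dvd_prod_subset) auto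
qed

text \<open>Induction on \<open>P\<close>: a divisor of \<open>q * \<Prod>P\<close> factors as
  \<open>b * c\<close> with \<open>b\<close> dividing \<open>q\<close> and \<open>c\<close> dividing
  \<open>\<Prod>P\<close>. As \<open>q\<close> is prime, \<open>b\<close> is \<open>1\<close> or
  \<open>q\<close>, which decides whether \<open>q\<close> joins the subset obtained for
  \<open>c\<close>.\<close>

lemma dvd_prod_primes_imp_prod_subset:
  fixes P :: "nat set"
  assumes "finite P" "\<forall>q\<in>P. prime q" "u dvd \<Prod>P"
  shows "\<exists>A\<subseteq>P. u = \<Prod>A"
  using assms
proof (induction P arbitrary: u rule: finite_induct)
  case empty
  then show ?case by auto
next
  case (insert q P)
  then have "u dvd q * \<Prod>P" by simp
  then obtain b c where u: "u = b * c" and "b dvd q" and "c dvd \<Prod>P"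
    by (meson division_decomp)
  with insert obtain A where A: "A \<subseteq> P" "c = \<Prod>A" by (metis insertCI)
  from insert \<open>b dvd q\<close> consider "b = 1" | "b = q"
    by (metis insertCI prime_nat_iff)
  then show ?case
  proof cases
    case 1
    with u A show ?thesis by auto
  next
    case 2
    have "finite A" "q \<notin> A" using A insert.hyps finite_subset by auto
    with 2 u A have "u = \<Prod>(insert q A)" by simp
    with A show ?thesis by blast
  qed
qed

lemma bij_betw_prod_positive_divisors:
  fixes P :: "nat set"
  assumes "finite P" "\<forall>q\<in>P. prime q"
  shows "bij_betw \<Prod> (Pow P) (positive_divisors (\<Prod>P))"
proof (rule bij_betw_imageI)
  have dvd: "\<Prod>A dvd \<Prod>B \<longleftrightarrow> A \<subseteq> B" if "A \<subseteq> P" "B \<subseteq> P" for A B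
    using that assms by (intro prod_primes_dvd_iff) (auto intro: finite_subset)
  show "inj_on \<Prod> (Pow P)"
  proof (rule inj_onI)
    \<comment> \<open>Equal products divide each other, so the two sets include each other.\<close>
    fix A B assume "A \<in> Pow P" "B \<in> Pow P" "\<Prod>A = \<Prod>B"
    with dvd[of A B] dvd[of B A] show "A = B" by simp
  qed
  have "0 < \<Prod>P" using assms by (auto intro!: prod_pos prime_gt_0_nat)
  then have "positive_divisors (\<Prod>P) = {u. u dvd \<Prod>P}"
    by (auto simp: positive_divisors_def intro: dvd_pos_nat)
  moreover have "\<Prod>A dvd \<Prod>P" if "A \<subseteq> P" for A
    using dvd[of A P] that by simp
  ultimately show "\<Prod> ` Pow P = positive_divisors (\<Prod>P)"
    using dvd_prod_primes_imp_prod_subset[OF assms] by blast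
qed

text \<open>Supersets of \<open>A\<close> within \<open>P\<close> correspond to subsets of
  \<open>P - A\<close> by adding or removing \<open>A\<close>. The set \<open>A\<close> is both a
  subset and a superset of itself, and it is excluded from each of the two families, whence the 2
  subtracted.\<close>

lemma card_comparable_subsets:
  assumes "finite P" "A \<subseteq> P"
  shows "int (card {B \<in> Pow P. B \<noteq> A \<and> (A \<subseteq> B \<or> B \<subseteq> A)}) =
    2 ^ card A + 2 ^ (card P - card A) - 2"
proof -
  have fin: "finite A" using assms finite_subset by blast
  have "bij_betw (\<lambda>C. A \<union> C) (Pow (P - A)) {B \<in> Pow P. A \<subseteq> B}"
    by (rule bij_betw_byWitness[where f' = "\<lambda>B. B - A"]) (use assms in auto)
  then have up: "card {B \<in> Pow P. A \<subseteq> B} = 2 ^ (card P - card A)"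
    using assms fin by (metis bij_betw_same_card card_Diff_subset card_Pow finite_Diff)
  have split: "{B \<in> Pow P. B \<noteq> A \<and> (A \<subseteq> B \<or> B \<subseteq> A)} =
      ({B \<in> Pow P. A \<subseteq> B} - {A}) \<union> (Pow A - {A})"
    using assms by auto
  \<comment> \<open>The two parts are disjoint, since only \<open>A\<close> itself is both a subset
    and a superset of \<open>A\<close>.\<close>
  have "card {B \<in> Pow P. B \<noteq> A \<and> (A \<subseteq> B \<or> B \<subseteq> A)} =
      (2 ^ (card P - card A) - 1) + (2 ^ card A - 1)"
    unfolding split using assms fin up
    by (subst card_Un_disjoint) (auto simp: card_Diff_singleton card_Pow)
  \<comment> \<open>These bounds ensure that the natural-number subtractions above are not
    truncated.\<close>
  moreover have "(1::nat) \<le> 2 ^ (card P - card A)" "(1::nat) \<le> 2 ^ card A" by simp_all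
  ultimately have "card {B \<in> Pow P. B \<noteq> A \<and> (A \<subseteq> B \<or> B \<subseteq> A)} + 2 =
      2 ^ card A + 2 ^ (card P - card A)"
    by linarith
  from arg_cong[OF this, of int] show ?thesis by simp
qed

lemma degree_prod_primes:
  fixes P :: "nat set"
  assumes "finite P" "\<forall>q\<in>P. prime q" "A \<subseteq> P"
  shows "int (degree (divisor_function_graph (\<Prod>P)) (\<Prod>A)) =
    2 ^ card A + 2 ^ (card P - card A) - 2"
proof -
  let ?V = "positive_divisors (\<Prod>P)"
  let ?S = "{B \<in> Pow P. B \<noteq> A \<and> (A \<subseteq> B \<or> B \<subseteq> A)}"
  note bij = bij_betw_prod_positive_divisors[OF assms(1,2)]
  have dvd: "\<Prod>B dvd \<Prod>C \<longleftrightarrow> B \<subseteq> C" if "B \<subseteq> P" "C \<subseteq> P" for B C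
    using that assms by (intro prod_primes_dvd_iff) (auto intro: finite_subset)
  have inj: "inj_on \<Prod> (Pow P)" and V: "?V = \<Prod> ` Pow P"
    using bij by (auto simp: bij_betw_def)
  have "{v \<in> ?V. v \<noteq> \<Prod>A \<and> (\<Prod>A dvd v \<or> v dvd \<Prod>A)} = \<Prod> ` ?S"
  proof -
    have "\<Prod>B \<noteq> \<Prod>A \<and> (\<Prod>A dvd \<Prod>B \<or> \<Prod>B dvd \<Prod>A) \<longleftrightarrow> B \<noteq> A \<and> (A \<subseteq> B \<or> B \<subseteq> A)"
      if "B \<subseteq> P" for B
      unfolding dvd[OF assms(3) that] dvd[OF that assms(3)]
      using that assms(3) inj_on_eq_iff[OF inj, of B A] by blast
    then show ?thesis
      unfolding V Compr_image_eq by (intro arg_cong[where f = "image \<Prod>"] Collect_cong) blast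
  qed
  moreover have "inj_on \<Prod> ?S" by (rule inj_on_subset[OF inj]) auto
  moreover have "\<Prod>A \<in> ?V" unfolding V using assms(3) by blast
  ultimately have "degree (divisor_function_graph (\<Prod>P)) (\<Prod>A) = card ?S"
    by (simp add: degree_divisor_function_graph card_image)
  then show ?thesis using card_comparable_subsets[OF assms(1,3)] by simp
qed

text \<open>Grouping the subsets by size puts \<open>card P choose j\<close> of them into class
  \<open>j\<close>, on which the summand is constant.\<close>

lemma sum_Pow_card:
  fixes g :: "nat \<Rightarrow> 'a::comm_semiring_1"
  assumes "finite P"
  shows "(\<Sum>A\<in>Pow P. g (card A)) = (\<Sum>j\<le>card P. of_nat (card P choose j) * g j)"
proof -
  have "(\<Sum>A\<in>Pow P. g (card A)) = (\<Sum>j\<le>card P. \<Sum>A | A \<in> Pow P \<and> card A = j. g (card A))"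
    using assms by (intro sum.group[symmetric]) (auto simp: card_mono)
  also have "\<dots> = (\<Sum>j\<le>card P. of_nat (card P choose j) * g j)"
    using assms by (intro sum.cong) (simp_all add: n_subsets)
  finally show ?thesis .
qed

lemma first_Zagreb_index_prod_primes:
  fixes P :: "nat set"
  assumes "finite P" "\<forall>q\<in>P. prime q"
  shows "int (first_Zagreb_index (divisor_function_graph (\<Prod>P))) =
    (\<Sum>j\<le>card P. int (card P choose j) * (2 ^ j + 2 ^ (card P - j) - 2)\<^sup>2)"
proof -
  let ?G = "divisor_function_graph (\<Prod>P)"
  have "int (first_Zagreb_index ?G) = (\<Sum>u\<in>positive_divisors (\<Prod>P). (int (degree ?G u))\<^sup>2)"
    by (simp add: first_Zagreb_index_def verts_def divisor_function_graph_def)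
  also have "\<dots> = (\<Sum>A\<in>Pow P. (int (degree ?G (\<Prod>A)))\<^sup>2)"
    by (rule sum.reindex_bij_betw[OF bij_betw_prod_positive_divisors[OF assms], symmetric])
  also have "\<dots> = (\<Sum>A\<in>Pow P. (2 ^ card A + 2 ^ (card P - card A) - 2)\<^sup>2)"
    using assms by (intro sum.cong) (simp_all add: degree_prod_primes)
  also have "\<dots> = (\<Sum>j\<le>card P. int (card P choose j) * (2 ^ j + 2 ^ (card P - j) - 2)\<^sup>2)"
    using sum_Pow_card[OF assms(1), of "\<lambda>j. (2 ^ j + 2 ^ (card P - j) - 2 :: int)\<^sup>2"] by simp
  finally show ?thesis .
qed

theorem theorem3p7:
  fixes k :: nat and p :: "nat \<Rightarrow> nat"
  assumes "\<And>i. i \<in> {1..k} \<Longrightarrow> prime (p i)"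
    and "inj_on p {1..k}"
  shows "int (first_Zagreb_index (divisor_function_graph (\<Prod>i = 1..k. p i))) =
    2 * (2 ^ k - 1)\<^sup>2 +
    (\<Sum>j = 1..k - 1. int (k choose j) * (2 ^ j + 2 ^ (k - j) - 2)\<^sup>2)"
proof -
  let ?P = "p ` {1..k}"
  let ?g = "\<lambda>j. int (k choose j) * (2 ^ j + 2 ^ (k - j) - 2)\<^sup>2"
  have "card ?P = k" using assms(2) by (simp add: card_image)
  moreover have "\<Prod>?P = (\<Prod>i = 1..k. p i)" using assms(2) by (simp add: prod.reindex)
  moreover have "\<forall>q\<in>?P. prime q" using assms(1) by blast
  ultimately have M: "int (first_Zagreb_index (divisor_function_graph (\<Prod>i = 1..k. p i))) = sum ?g {..k}"
    using first_Zagreb_index_prod_primes[of ?P] by simp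
  show ?thesis
  proof (cases "k = 0")
    \<comment> \<open>Here the indices 0 and \<open>k\<close> coincide; the only term is (1 + 1 -
      2)^2 = 0, and the right-hand side vanishes too, its sum being empty.\<close>
    case True
    with M show ?thesis by simp
  next
    case False
    then have "{..k} = insert 0 (insert k {1..k - 1})" by auto
    with False have "sum ?g {..k} = ?g 0 + (?g k + sum ?g {1..k - 1})" by simp
    \<comment> \<open>Both end terms have binomial coefficient 1 and base 1 + 2^k - 2 = 2^k -
      1.\<close>
    also have "\<dots> = 2 * (2 ^ k - 1)\<^sup>2 + sum ?g {1..k - 1}" by simp
    finally show ?thesis using M by simp
  qed
qed

end
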